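(* Let $d\in\{2,3\}$, $\Delta t>0$, $\overline\varkappa\in\mathbb{R}$, and let $\Gamma^0,\Gamma^1,\Gamma^2,\dots$ be closed polyhedral surfaces in $\mathbb{R}^d$ generated, starting from $\Gamma^0$ (with $\Gamma^{-1}=\Gamma^0$) and initial $\varkappa^0,\kappa^0\in\mathbb{V}^h(\Gamma^0)$, by the following two-stage procedure for each $m\ge0$: $(\mathscr{V}^{m+1},\varkappa^{m+1},\lambda^{m+1},\mu^{m+1})\in[\mathbb{V}^h(\Gamma^m)]^2\times\mathbb{R}^2$ is a solution of the system (S1)--(S4) of the context; $(\vec X^{m+1},\kappa^{m+1},\alpha^{m+1})\in[\mathbb{V}^h(\Gamma^m)]^d\times\mathbb{V}^h(\Gamma^m)\times\mathbb{R}$ is a solution of the nonlinear system (M1)--(M3) of the context; and $\Gamma^{m+1}=\vec X^{m+1}(\Gamma^m)$. Then $$\mathrm{vol}(\Gamma^{m+1})=\mathrm{vol}(\Gamma^m)\qquad\text{and}\qquad|\Gamma^{m+1}|=|\Gamma^m|\qquad\text{for all } m\ge0,$$ where $\mathrm{vol}(\Gamma^m)=\frac1d\int_{\Gamma^m}\vec{\mathrm{id}}\cdot\vec\nu^m\,d\mathcal{H}^{d-1}$ and $|\Gamma^m|=\int_{\Gamma^m}1\,d\mathcal{H}^{d-1}$.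
   Context: Polyhedral surfaces. For each $m$, $\Gamma^m=\bigcup_{j=1}^J\overline{\sigma_j^m}\subset\mathbb{R}^d$ is a closed (boundaryless), oriented polyhedral hypersurface, where $\mathscr{T}^m=\{\sigma_j^m\}_{j=1}^J$ are mutually disjoint open nondegenerate $(d-1)$-simplices (segments if $d=2$, triangles if $d=3$) with vertex set $\{\vec q_k^m\}_{k=1}^K$; the connectivity of the mesh is the same for all $m$, and $\vec q_k^{m+1}=\vec X^{m+1}(\vec q_k^m)$. By convention $\Gamma^{-1}=\Gamma^0$. Let $\vec q_{j_1}^m,\dots,\vec q_{j_d}^m$ be the vertices of $\sigma_j^m$, ordered consistently with the outward orientation, and let $\vec N(\sigma_j^m)=(\vec q_{j_2}^m-\vec q_{j_1}^m)^\perp$ for $d=2$ ($\perp$ = clockwise rotation by $\pi/2$), $\vec N(\sigma_j^m)=(\vec q_{j_2}^m-\vec q_{j_1}^m)\times(\vec q_{j_3}^m-\vec q_{j_1}^m)$ for $d=3$; the unit normal is $\vec\nu^m|_{\sigma_j^m}=\vec N(\sigma_j^m)/|\vec N(\sigma_j^m)|$, and $|\sigma_j^m|=\frac1{(d-1)!}|\vec N(\sigma_j^m)|$. Spaces and inner products. $\mathbb{V}^h(\Gamma^m)=\{\varphi\in C(\Gamma^m):\varphi|_\sigma\text{ affine for all }\sigma\in\mathscr{T}^m\}$; $(\cdot,\cdot)_{\Gamma^m}$ is the $L^2(\Gamma^m)$ inner product (for scalars, vectors, matrices); $\nabla_s$ is the elementwise tangential gradient. The mass-lumped product is $(u,v)^h_{\Gamma^m}=\frac1d\sum_{j=1}^J|\sigma_j^m|\sum_{k=1}^d\lim_{\sigma_j^m\ni\vec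 p\to\vec q_{j_k}^m}(u\cdot v)(\vec p)$ for piecewise continuous $u,v$. Vertex normals. $\vec\omega^m\in[\mathbb{V}^h(\Gamma^m)]^d$ is defined by $(\vec\omega^m,\vec\eta^h)^h_{\Gamma^m}=(\vec\nu^m,\vec\eta^h)_{\Gamma^m}$ for all $\vec\eta^h\in[\mathbb{V}^h(\Gamma^m)]^d$; it is assumed nonzero at every vertex. $\vec v^m\in[\mathbb{V}^h(\Gamma^m)]^d$ has vertex values $\vec\omega^m(\vec q)/|\vec\omega^m(\vec q)|$, and $\mathcal{W}^m=|\nabla_s\vec v^m|^2$ (Frobenius norm squared). Mesh velocity and pullback. $\vec{\mathscr{V}}^m\in[\mathbb{V}^h(\Gamma^m)]^d$ is given by $\vec{\mathscr{V}}^m(\vec q_k^m)=(\vec q_k^m-\vec q_k^{m-1})/\Delta t$ (so $\vec{\mathscr V}^0=\vec 0$), and $\vec\Phi^m=\vec{\mathrm{id}}|_{\Gamma^m}-\Delta t\,\vec{\mathscr{V}}^m$, so $\vec\Phi^m(\Gamma^m)=\Gamma^{m-1}$. $\mathcal{J}^m=\sqrt{\det\mathcal{L}^m}$ is the surface Jacobian of $\vec\Phi^m$, where $\mathcal{L}^m=(\nabla_s\vec\Phi^m)^T\nabla_s\vec\Phi^m$ is viewed as a linear operator on the tangent space of $\Gamma^m$. $\varkappa^m,\kappa^m\in\mathbb{V}^h(\Gamma^{m-1})$, $\varkappa^m_{\Gamma^m}=\varkappa^m\circ\vec\Phi^m\in\mathbb{V}^h(\Gamma^m)$, and $\kappa^m$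 is also regarded as an element of $\mathbb{V}^h(\Gamma^m)$ through its vertex values (i.e. composed with $\vec\Phi^m$). Antisymmetric form. $\mathscr{A}_{\Gamma^m}(\vec\eta,u,v)=\frac12(\vec\eta\cdot\nabla_su,v)_{\Gamma^m}-\frac12(\vec\eta\cdot\nabla_sv,u)_{\Gamma^m}$. First-stage system, required for all $\varphi^h,\chi^h\in\mathbb{V}^h(\Gamma^m)$: (S1) $(\mathscr{V}^{m+1},\varphi^h)_{\Gamma^m}-(\nabla_s\varkappa^{m+1},\nabla_s\varphi^h)_{\Gamma^m}+(\mathcal{W}^m[\varkappa^{m+1}-\overline{\varkappa}],\varphi^h)_{\Gamma^m}-\frac12([\varkappa^m_{\Gamma^m}-\overline{\varkappa}]\varkappa^m_{\Gamma^m}[\varkappa^{m+1}-\overline{\varkappa}],\varphi^h)_{\Gamma^m}-\lambda^{m+1}(1,\varphi^h)_{\Gamma^m}-\mu^{m+1}(\kappa^m,\varphi^h)_{\Gamma^m}=0$; (S2) $\Big(\frac{\varkappa^{m+1}-\overline{\varkappa}-(\varkappa^m_{\Gamma^m}-\overline{\varkappa})\sqrt{\mathcal{J}^m}}{\Delta t},\chi^h\Big)_{\Gamma^m}-\mathscr{A}_{\Gamma^m}(\vec{\mathscr{V}}^m,\varkappa^{m+1}-\overline{\varkappa},\chi^h)+(\nabla_s\mathscr{V}^{m+1},\nabla_s\chi^h)_{\Gamma^m}-(\mathcal{W}^m\mathscr{V}^{m+1},\chi^h)_{\Gamma^m}+\frac12(\mathscr{V}^{m+1},[\varkappa^m_{\Gamma^m}-\overline{\varkappa}]\varkappa^m_{\Gamma^m}\chi^h)_{\Gamma^m}=0$;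 (S3) $(\mathscr{V}^{m+1},1)_{\Gamma^m}=0$; (S4) $(\mathscr{V}^{m+1}\kappa^m,1)_{\Gamma^m}=0$. Time-weighted normals. With $\sigma_j^{m+1}$ the simplex with vertices $\vec q_{j_k}^{m+1}=\vec X^{m+1}(\vec q_{j_k}^m)$ and, for $d=3$, $\sigma_j^{m+\frac12}$ the triangle with vertices $\frac12(\vec q_{j_k}^m+\vec q_{j_k}^{m+1})$, define elementwise on $\Gamma^m$ $$\vec\nu^{m+\frac12}|_{\sigma_j^m}=\frac{\vec N(\sigma_j^m)+\vec N(\sigma_j^{m+1})}{2|\vec N(\sigma_j^m)|}\ (d=2),\qquad \vec\nu^{m+\frac12}|_{\sigma_j^m}=\frac{\vec N(\sigma_j^m)+4\vec N(\sigma_j^{m+\frac12})+\vec N(\sigma_j^{m+1})}{6|\vec N(\sigma_j^m)|}\ (d=3).$$ Second-stage (mesh update) system, required for all $\xi^h\in\mathbb{V}^h(\Gamma^m)$, $\vec\eta^h\in[\mathbb{V}^h(\Gamma^m)]^d$, with $\bar\kappa^m=(\kappa^m,1)^h_{\Gamma^m}/(1,1)^h_{\Gamma^m}$: (M1) $\Big(\frac{\vec X^{m+1}-\vec{\mathrm{id}}}{\Delta t}\cdot\vec\nu^{m+\frac12},\xi^h\Big)^h_{\Gamma^m}=(\mathscr{V}^{m+1},\xi^h)_{\Gamma^m}+\alpha^{m+1}(\kappa^m-\bar\kappa^m,\xi^h)^h_{\Gamma^m}$; (M2) $(\kappa^{m+1}\vec\nu^m,\vec\eta^h)^h_{\Gamma^m}+(\nabla_s\vec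 X^{m+1},\nabla_s\vec\eta^h)_{\Gamma^m}=0$; (M3) $|\Gamma^{m+1}|=|\Gamma^0|$. *)

theory Defs
  imports "HOL-Analysis.Analysis"
begin

section \<open>Dimension-specific data\<close>

text \<open>
  A simplex of dimension \<open>d - 1\<close> in \<open>\<real>\<^sup>d\<close> is given by its tuple of vertices
  \<^typ>\<open>'n \<Rightarrow> real^'n\<close> with \<open>d = CARD('n)\<close>. In the type \<^typ>\<open>2\<close> the numeral \<open>2\<close>
  denotes the same element as \<open>0\<close>, and likewise for \<open>3\<close> in \<^typ>\<open>3\<close>; so \<open>v 1, ..., v d\<close> are
  exactly the \<open>d\<close> entries of a tuple.
\<close>

definition clockwise_rot :: "real^2 \<Rightarrow> real^2" where
  "clockwise_rot x = vector [x $ 2, - x $ 1]"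

definition normal2 :: "(2 \<Rightarrow> real^2) \<Rightarrow> real^2" where
  "normal2 v = clockwise_rot (v 2 - v 1)"

definition normal3 :: "(3 \<Rightarrow> real^3) \<Rightarrow> real^3" where
  "normal3 v = cross3 (v 2 - v 1) (v 3 - v 1)"

text \<open>The time-weighted normals, before division by the length of the old normal.\<close>

definition mean_normal2 :: "(2 \<Rightarrow> real^2) \<Rightarrow> (2 \<Rightarrow> real^2) \<Rightarrow> real^2" where
  "mean_normal2 v w = (1/2) *\<^sub>R (normal2 v + normal2 w)"

definition mean_normal3 :: "(3 \<Rightarrow> real^3) \<Rightarrow> (3 \<Rightarrow> real^3) \<Rightarrow> real^3" where
  "mean_normal3 v w =
     (1/6) *\<^sub>R (normal3 v + 4 *\<^sub>R normal3 (\<lambda>k. (1/2) *\<^sub>R (v k + w k)) + normal3 w)"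

text \<open>
  Integration over an open simplex with respect to the surface measure \<open>\<H>\<^sup>d\<^sup>-\<^sup>1\<close>, as the usual
  curve and surface integrals in the affine parametrization by the reference simplex: the length
  element is \<open>\<bar>v\<^sub>2 - v\<^sub>1\<bar> ds\<close>, the area element
  \<open>\<bar>(v\<^sub>2 - v\<^sub>1) \<times> (v\<^sub>3 - v\<^sub>1)\<bar> ds dt\<close>.
\<close>

definition segment_integral :: "(2 \<Rightarrow> real^2) \<Rightarrow> (real^2 \<Rightarrow> real) \<Rightarrow> real" where
  "segment_integral v f =
     (LINT s:{0<..<1}|lborel. f (v 1 + s *\<^sub>R (v 2 - v 1)) * norm (v 2 - v 1))"

definition triangle_integral :: "(3 \<Rightarrow> real^3) \<Rightarrow> (real^3 \<Rightarrow> real) \<Rightarrow> real" where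
  "triangle_integral v f =
     (LINT p:{(s, t). 0 < s \<and> 0 < t \<and> s + t < 1}|lborel.
        f (v 1 + fst p *\<^sub>R (v 2 - v 1) + snd p *\<^sub>R (v 3 - v 1))
        * norm (cross3 (v 2 - v 1) (v 3 - v 1)))"


section \<open>Meshes\<close>

text \<open>
  Vertices are numbered \<open>0, ..., nverts - 1\<close>, simplices \<open>0, ..., nsimps - 1\<close>;
  \<open>vidx M j k\<close> is the index \<open>j\<^sub>k\<close> of the \<open>k\<close>-th vertex of the \<open>j\<close>-th simplex.
\<close>

record ('n::finite) mesh =
  nverts :: nat
  nsimps :: nat
  vidx :: "nat \<Rightarrow> 'n \<Rightarrow> nat"
  vert :: "nat \<Rightarrow> real^'n"

definition verts :: "'n::finite mesh \<Rightarrow> nat \<Rightarrow> 'n \<Rightarrow> real^'n" where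
  "verts M j k = vert M (vidx M j k)"

definition cell :: "'n::finite mesh \<Rightarrow> nat \<Rightarrow> (real^'n) set" where
  "cell M j = rel_interior (convex hull (range (verts M j)))"

definition surface :: "'n::finite mesh \<Rightarrow> (real^'n) set" where
  "surface M = (\<Union>j<nsimps M. closure (cell M j))"

text \<open>The mesh with the same connectivity whose vertices are the images of the old ones.\<close>

definition move :: "(real^'n \<Rightarrow> real^'n) \<Rightarrow> 'n::finite mesh \<Rightarrow> 'n mesh" where
  "move X M = M\<lparr>vert := (\<lambda>k. X (vert M k))\<rparr>"

text \<open>Piecewise affine, continuous finite elements; only the values on the surface matter.\<close>

definition Vh :: "'n::finite mesh \<Rightarrow> (real^'n \<Rightarrow> real) set" where
  "Vh M = {\<phi>. continuous_on (surface M) \<phi> \<and>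
              (\<forall>j<nsimps M. \<exists>a b. \<forall>p\<in>cell M j. \<phi> p = a \<bullet> p + b)}"

definition Vh_vec :: "'n::finite mesh \<Rightarrow> (real^'n \<Rightarrow> real^'n) set" where
  "Vh_vec M = {\<eta>. \<forall>i. (\<lambda>p. \<eta> p $ i) \<in> Vh M}"

text \<open>
  Elementwise defined quantities are functions on the ambient space, evaluated through the
  simplex containing the point. They are meaningful on the union of the open simplices only, which
  is all that the surface integrals and the one-sided vertex limits see.
\<close>

definition elem :: "'n::finite mesh \<Rightarrow> real^'n \<Rightarrow> nat" where
  "elem M p = (THE j. j < nsimps M \<and> p \<in> cell M j)"

definition outer :: "real^'n \<Rightarrow> real^'n \<Rightarrow> real^'n^'n" where
  "outer a b = (\<chi> i j. a $ i * b $ j)"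

text \<open>
  The determinant of \<open>A\<close> as a linear operator on the tangent space orthogonal to the unit vector
  \<open>\<nu>\<close> (which \<open>A\<close> maps into itself): \<open>A\<close> is extended from the tangent space to the whole space by the
  identity on the normal line, which contributes the factor \<open>1\<close>.
\<close>

definition tangential_det :: "real^'n \<Rightarrow> real^'n^'n \<Rightarrow> real" where
  "tangential_det \<nu> A = det (A ** (mat 1 - outer \<nu> \<nu>) + outer \<nu> \<nu>)"


section \<open>The scheme\<close>

text \<open>
  Everything else is uniform in the dimension. Parameters: the normal \<open>N\<close> of a simplex, the
  time-weighted normal \<open>Nmean\<close> of an old and a new simplex, and integration \<open>sint\<close> over an open
  simplex. The two instances are interpreted at the end.
\<close>

locale surface_scheme =
  fixes N :: "('n::finite \<Rightarrow> real^'n) \<Rightarrow> real^'n"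
    and Nmean :: "('n \<Rightarrow> real^'n) \<Rightarrow> ('n \<Rightarrow> real^'n) \<Rightarrow> real^'n"
    and sint :: "('n \<Rightarrow> real^'n) \<Rightarrow> (real^'n \<Rightarrow> real) \<Rightarrow> real"
begin

subsection \<open>Geometry\<close>

text \<open>
  \<open>coherent\<close>: whenever two distinct simplices share a facet, matching their vertex tuples along it
  is an odd permutation, i.e. they induce opposite orientations on the facet.
  \<open>outward\<close>: the surface bounds a bounded open region and \<open>N\<close> points out of it.
\<close>

definition conforming :: "'n mesh \<Rightarrow> bool" where
  "conforming M \<longleftrightarrow>
     inj_on (vert M) {..<nverts M} \<and>
     (\<Union>j<nsimps M. range (vidx M j)) = {..<nverts M} \<and>
     (\<forall>j<nsimps M. inj (vidx M j) \<and> \<not> affine_dependent (range (verts M j))) \<and>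
     (\<forall>i<nsimps M. \<forall>j<nsimps M. i \<noteq> j \<longrightarrow>
        cell M i \<inter> cell M j = {} \<and>
        closure (cell M i) \<inter> closure (cell M j)
          = convex hull (range (verts M i) \<inter> range (verts M j)))"

definition boundaryless :: "'n mesh \<Rightarrow> bool" where
  "boundaryless M \<longleftrightarrow>
     (\<forall>j<nsimps M. \<forall>k. \<exists>!i. i < nsimps M \<and> i \<noteq> j \<and> vidx M j ` (- {k}) \<subseteq> range (vidx M i))"

definition hypersurface :: "'n mesh \<Rightarrow> bool" where
  "hypersurface M \<longleftrightarrow>
     (\<forall>p\<in>surface M. \<exists>U. openin (top_of_set (surface M)) U \<and> p \<in> U \<and>
        (\<exists>T :: (real^'n) set. subspace T \<and> dim T = CARD('n) - 1 \<and> U homeomorphic T))"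

definition coherent :: "'n mesh \<Rightarrow> bool" where
  "coherent M \<longleftrightarrow>
     (\<forall>i<nsimps M. \<forall>j<nsimps M. \<forall>\<pi> k. i \<noteq> j \<and> \<pi> permutes UNIV \<and>
        (\<forall>r. r \<noteq> k \<longrightarrow> vidx M i (\<pi> r) = vidx M j r) \<longrightarrow> \<not> evenperm \<pi>)"

definition outward :: "'n mesh \<Rightarrow> bool" where
  "outward M \<longleftrightarrow>
     (\<exists>\<Omega>. open \<Omega> \<and> bounded \<Omega> \<and> frontier \<Omega> = surface M \<and>
        (\<forall>j<nsimps M. \<forall>p\<in>cell M j. \<exists>\<epsilon>>0. \<forall>t\<in>{0<..<\<epsilon>}.
           p - t *\<^sub>R N (verts M j) \<in> \<Omega> \<and> p + t *\<^sub>R N (verts M j) \<notin> closure \<Omega>))"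

definition polyhedral_surface :: "'n mesh \<Rightarrow> bool" where
  "polyhedral_surface M \<longleftrightarrow>
     0 < nsimps M \<and> conforming M \<and> boundaryless M \<and> hypersurface M \<and> coherent M \<and> outward M"

definition simplex_measure :: "'n mesh \<Rightarrow> nat \<Rightarrow> real" where
  "simplex_measure M j = norm (N (verts M j)) / fact (CARD('n) - 1)"

definition unit_normal :: "'n mesh \<Rightarrow> real^'n \<Rightarrow> real^'n" where
  "unit_normal M p = (let n = N (verts M (elem M p)) in n /\<^sub>R norm n)"

definition surf_int :: "'n mesh \<Rightarrow> (real^'n \<Rightarrow> real) \<Rightarrow> real" where
  "surf_int M f = (\<Sum>j<nsimps M. sint (verts M j) f)"

definition area :: "'n mesh \<Rightarrow> real" where
  "area M = surf_int M (\<lambda>p. 1)"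

definition vol :: "'n mesh \<Rightarrow> real" where
  "vol M = 1 / real CARD('n) * surf_int M (\<lambda>p. p \<bullet> unit_normal M p)"

subsection \<open>Inner products and tangential gradients\<close>

text \<open>
  On matrices, i.e. vectors of vectors, the inner product and the norm are the Frobenius ones.
\<close>

definition ip :: "'n mesh \<Rightarrow> (real^'n \<Rightarrow> 'b::real_inner) \<Rightarrow> (real^'n \<Rightarrow> 'b) \<Rightarrow> real" where
  "ip M u v = surf_int M (\<lambda>p. u p \<bullet> v p)"

definition iph :: "'n mesh \<Rightarrow> (real^'n \<Rightarrow> 'b::real_inner) \<Rightarrow> (real^'n \<Rightarrow> 'b) \<Rightarrow> real" where
  "iph M u v =
     1 / real CARD('n) * (\<Sum>j<nsimps M. simplex_measure M j *
       (\<Sum>k\<in>UNIV. Lim (at (verts M j k) within cell M j) (\<lambda>p. u p \<bullet> v p)))"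

definition grad :: "'n mesh \<Rightarrow> (real^'n \<Rightarrow> real) \<Rightarrow> real^'n \<Rightarrow> real^'n" where
  "grad M \<phi> p = (THE g. g \<bullet> N (verts M (elem M p)) = 0 \<and>
     (\<phi> has_derivative (\<lambda>h. g \<bullet> h)) (at p within cell M (elem M p)))"

text \<open>Row \<open>i\<close> is the tangential gradient of the \<open>i\<close>-th component.\<close>

definition grad_vec :: "'n mesh \<Rightarrow> (real^'n \<Rightarrow> real^'n) \<Rightarrow> real^'n \<Rightarrow> real^'n^'n" where
  "grad_vec M \<eta> p = (\<chi> i. grad M (\<lambda>x. \<eta> x $ i) p)"

definition antisym_form ::
    "'n mesh \<Rightarrow> (real^'n \<Rightarrow> real^'n) \<Rightarrow> (real^'n \<Rightarrow> real) \<Rightarrow> (real^'n \<Rightarrow> real) \<Rightarrow> real" where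
  "antisym_form M \<eta> u v =
     1/2 * ip M (\<lambda>p. \<eta> p \<bullet> grad M u p) v - 1/2 * ip M (\<lambda>p. \<eta> p \<bullet> grad M v p) u"

subsection \<open>Vertex normals, mesh velocity, surface Jacobian\<close>

definition is_vertex_normal :: "'n mesh \<Rightarrow> (real^'n \<Rightarrow> real^'n) \<Rightarrow> bool" where
  "is_vertex_normal M \<omega> \<longleftrightarrow>
     \<omega> \<in> Vh_vec M \<and> (\<forall>\<eta>\<in>Vh_vec M. iph M \<omega> \<eta> = ip M (unit_normal M) \<eta>)"

definition is_normalized :: "'n mesh \<Rightarrow> (real^'n \<Rightarrow> real^'n) \<Rightarrow> (real^'n \<Rightarrow> real^'n) \<Rightarrow> bool" where
  "is_normalized M \<omega> v \<longleftrightarrow>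
     v \<in> Vh_vec M \<and> (\<forall>k<nverts M. v (vert M k) = \<omega> (vert M k) /\<^sub>R norm (\<omega> (vert M k)))"

definition is_mesh_velocity ::
    "real \<Rightarrow> 'n mesh \<Rightarrow> 'n mesh \<Rightarrow> (real^'n \<Rightarrow> real^'n) \<Rightarrow> bool" where
  "is_mesh_velocity \<Delta>t Mold M W \<longleftrightarrow>
     W \<in> Vh_vec M \<and> (\<forall>k<nverts M. W (vert M k) = (vert M k - vert Mold k) /\<^sub>R \<Delta>t)"

definition jacobian :: "'n mesh \<Rightarrow> (real^'n \<Rightarrow> real^'n) \<Rightarrow> real^'n \<Rightarrow> real" where
  "jacobian M \<Phi> p =
     sqrt (tangential_det (unit_normal M p) (transpose (grad_vec M \<Phi> p) ** grad_vec M \<Phi> p))"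

subsection \<open>The two stages\<close>

text \<open>
  The two curvature unknowns of the scheme (a script and an upright kappa) are \<open>c\<close> and \<open>\<kappa>\<close>;
  \<open>c\<^sub>0\<close> is the spontaneous curvature. \<open>c\<close> and \<open>\<kappa>\<close> denote the old values pulled back to the
  current surface, \<open>c'\<close> and \<open>\<kappa>'\<close> the new ones; \<open>V\<close> is the new scalar normal velocity, \<open>W\<close> the mesh
  velocity, and \<open>w\<close> the function \<open>\<bar>\<nabla>\<^sub>s v\<bar>\<^sup>2\<close> of the normalized vertex normals.
\<close>

definition first_stage ::
    "real \<Rightarrow> real \<Rightarrow> 'n mesh \<Rightarrow> (real^'n \<Rightarrow> real^'n) \<Rightarrow> (real^'n \<Rightarrow> real) \<Rightarrow> (real^'n \<Rightarrow> real) \<Rightarrow>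
     (real^'n \<Rightarrow> real) \<Rightarrow> (real^'n \<Rightarrow> real) \<Rightarrow>
     (real^'n \<Rightarrow> real) \<Rightarrow> (real^'n \<Rightarrow> real) \<Rightarrow> real \<Rightarrow> real \<Rightarrow> bool" where
  "first_stage \<Delta>t c\<^sub>0 M W J w c \<kappa> V c' l \<mu> \<longleftrightarrow>
     V \<in> Vh M \<and> c' \<in> Vh M \<and>
     (\<forall>\<phi>\<in>Vh M.
        ip M V \<phi> - ip M (grad M c') (grad M \<phi>)
        + ip M (\<lambda>p. w p * (c' p - c\<^sub>0)) \<phi>
        - 1/2 * ip M (\<lambda>p. (c p - c\<^sub>0) * c p * (c' p - c\<^sub>0)) \<phi>
        - l * ip M (\<lambda>p. 1) \<phi> - \<mu> * ip M \<kappa> \<phi> = 0) \<and>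
     (\<forall>\<psi>\<in>Vh M.
        ip M (\<lambda>p. (c' p - c\<^sub>0 - (c p - c\<^sub>0) * sqrt (J p)) / \<Delta>t) \<psi>
        - antisym_form M W (\<lambda>p. c' p - c\<^sub>0) \<psi>
        + ip M (grad M V) (grad M \<psi>)
        - ip M (\<lambda>p. w p * V p) \<psi>
        + 1/2 * ip M V (\<lambda>p. (c p - c\<^sub>0) * c p * \<psi> p) = 0) \<and>
     ip M V (\<lambda>p. 1) = 0 \<and>
     ip M (\<lambda>p. V p * \<kappa> p) (\<lambda>p. 1) = 0"

definition weighted_normal :: "'n mesh \<Rightarrow> (real^'n \<Rightarrow> real^'n) \<Rightarrow> real^'n \<Rightarrow> real^'n" where
  "weighted_normal M X p =
     (let v = verts M (elem M p) in Nmean v (\<lambda>k. X (v k)) /\<^sub>R norm (N v))"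

definition second_stage ::
    "real \<Rightarrow> 'n mesh \<Rightarrow> 'n mesh \<Rightarrow> (real^'n \<Rightarrow> real) \<Rightarrow> (real^'n \<Rightarrow> real) \<Rightarrow>
     (real^'n \<Rightarrow> real^'n) \<Rightarrow> (real^'n \<Rightarrow> real) \<Rightarrow> real \<Rightarrow> bool" where
  "second_stage \<Delta>t M\<^sub>0 M V \<kappa> X \<kappa>' \<alpha> \<longleftrightarrow>
     X \<in> Vh_vec M \<and> \<kappa>' \<in> Vh M \<and>
     (\<forall>\<xi>\<in>Vh M.
        iph M (\<lambda>p. ((X p - p) /\<^sub>R \<Delta>t) \<bullet> weighted_normal M X p) \<xi>
        = ip M V \<xi>
          + \<alpha> * iph M (\<lambda>p. \<kappa> p - iph M \<kappa> (\<lambda>p. 1) / iph M (\<lambda>p. 1 :: real) (\<lambda>p. 1)) \<xi>) \<and>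
     (\<forall>\<eta>\<in>Vh_vec M.
        iph M (\<lambda>p. \<kappa>' p *\<^sub>R unit_normal M p) \<eta> + ip M (grad_vec M X) (grad_vec M \<eta>) = 0) \<and>
     area (move X M) = area M\<^sub>0"

text \<open>
  Sequences are indexed as in the scheme: \<open>V\<close>, \<open>c\<close>, \<open>\<kappa>\<close>, \<open>l\<close>, \<open>\<mu>\<close>, \<open>X\<close>, \<open>\<alpha>\<close> at \<open>Suc m\<close> are the unknowns
  solved for on \<open>\<Gamma> m\<close>; except for \<open>c\<close> and \<open>\<kappa>\<close>, the entry at \<open>0\<close> is unused. Natural subtraction gives
  \<open>\<Gamma> (0 - 1) = \<Gamma> 0\<close>, which is the convention for the surface before the initial one.
\<close>

definition two_stage_evolution ::
    "real \<Rightarrow> real \<Rightarrow> (nat \<Rightarrow> 'n mesh) \<Rightarrow> (nat \<Rightarrow> real^'n \<Rightarrow> real) \<Rightarrow> (nat \<Rightarrow> real^'n \<Rightarrow> real) \<Rightarrow>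
     (nat \<Rightarrow> real) \<Rightarrow> (nat \<Rightarrow> real) \<Rightarrow> (nat \<Rightarrow> real^'n \<Rightarrow> real^'n) \<Rightarrow>
     (nat \<Rightarrow> real^'n \<Rightarrow> real) \<Rightarrow> (nat \<Rightarrow> real) \<Rightarrow> bool" where
  "two_stage_evolution \<Delta>t c\<^sub>0 \<Gamma> V c l \<mu> X \<kappa> \<alpha> \<longleftrightarrow>
     (\<forall>m. polyhedral_surface (\<Gamma> m)) \<and>
     c 0 \<in> Vh (\<Gamma> 0) \<and> \<kappa> 0 \<in> Vh (\<Gamma> 0) \<and>
     (\<forall>m. \<Gamma> (Suc m) = move (X (Suc m)) (\<Gamma> m)) \<and>
     (\<forall>m. \<exists>\<omega> v W.
        is_vertex_normal (\<Gamma> m) \<omega> \<and> (\<forall>k<nverts (\<Gamma> m). \<omega> (vert (\<Gamma> m) k) \<noteq> 0) \<and>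
        is_normalized (\<Gamma> m) \<omega> v \<and>
        is_mesh_velocity \<Delta>t (\<Gamma> (m - 1)) (\<Gamma> m) W \<and>
        (let \<Phi> = (\<lambda>p. p - \<Delta>t *\<^sub>R W p) in
           first_stage \<Delta>t c\<^sub>0 (\<Gamma> m) W (jacobian (\<Gamma> m) \<Phi>) (\<lambda>p. (norm (grad_vec (\<Gamma> m) v p))\<^sup>2)
             (c m \<circ> \<Phi>) (\<kappa> m \<circ> \<Phi>) (V (Suc m)) (c (Suc m)) (l (Suc m)) (\<mu> (Suc m)) \<and>
           second_stage \<Delta>t (\<Gamma> 0) (\<Gamma> m) (V (Suc m)) (\<kappa> m \<circ> \<Phi>)
             (X (Suc m)) (\<kappa> (Suc m)) (\<alpha> (Suc m))))"

end

interpretation d2: surface_scheme normal2 mean_normal2 segment_integral .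
interpretation d3: surface_scheme normal3 mean_normal3 triangle_integral .

end

theory Submission
  imports Defs
begin

text \<open>
  Area is conserved because every step prescribes the initial area for the surface it produces, so
  all areas equal that of \<open>\<Gamma> 0\<close>.

  For the volume, the normal velocity equation of the second stage is tested with the constant
  function \<open>1\<close>. The right-hand side vanishes: the first stage makes \<open>V\<close> orthogonal to constants, and
  the forcing term is the deviation of \<open>\<kappa>\<close> from its mean with respect to the same mass-lumped product
  (\<open>iph_deviation_from_mean\<close>). On the left, mass lumping turns the product into a vertex sum
  (\<open>iph_displacement\<close>), so that
  \<open>(\<Sum>j. \<Sum>k. (w\<^sub>j\<^sub>k - v\<^sub>j\<^sub>k) \<bullet> Nmean v\<^sub>j w\<^sub>j) = 0\<close>
  for the old and new vertices \<open>v\<^sub>j\<^sub>k\<close> and \<open>w\<^sub>j\<^sub>k\<close> of the \<open>j\<close>-th simplex.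

  Let the vertices travel linearly from old to new position. The normal of a moving simplex is then
  a polynomial in time of degree \<open>d - 1\<close>, and \<open>Nmean\<close> is its exact time average (trapezoidal rule
  for \<open>d = 2\<close>, Simpson's rule for \<open>d = 3\<close>). Hence the sum over \<open>k\<close> is, up to a factorial, the volume
  swept by the simplex, which differs from the change of the signed volume of the cone over the simplex
  with apex at the origin only by the contributions of the lateral faces of the cone, one for each
  facet of the simplex (\<open>mean_normal2_identity\<close>, \<open>mean_normal3_identity\<close>). On a closed, coherently
  oriented mesh every facet belongs to exactly two simplices, which see it with opposite
  orientations, so the lateral contributions cancel (\<open>flux_sum_zero\<close>). What remains is the change of
  the sum of all cone volumes, which is the enclosed volume (\<open>vol_eq_sum\<close>).

  The vertex sums are legitimate only if the mass-lumped products see honest limits at the vertices.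
  For \<open>\<kappa>\<close>, which lives on the previous surface, this uses that the pullback \<open>id - \<Delta>t W\<close> maps the
  current surface into the previous one, simplex by simplex (\<open>velocity_pullback_in_surface\<close>).
\<close>

section \<open>A pairing argument\<close>

text \<open>
  The relation \<open>R\<close> is the graph of an involution of \<open>F\<close> that changes the sign of \<open>f\<close>, so the sum is
  its own negative.
\<close>

lemma sum_eq_zero_of_pairing:
  fixes f :: "'a \<Rightarrow> real"
  assumes "finite F"
    and ex1: "\<And>x. x \<in> F \<Longrightarrow> \<exists>!y. y \<in> F \<and> R x y"
    and sym: "\<And>x y. x \<in> F \<Longrightarrow> y \<in> F \<Longrightarrow> R x y \<Longrightarrow> R y x"
    and anti: "\<And>x y. x \<in> F \<Longrightarrow> y \<in> F \<Longrightarrow> R x y \<Longrightarrow> f y = - f x"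
  shows "sum f F = 0"
proof -
  define p where "p x = (THE y. y \<in> F \<and> R x y)" for x
  have p: "p x \<in> F \<and> R x (p x)" if "x \<in> F" for x
    unfolding p_def by (rule theI'[OF ex1[OF that]])
  have pp: "p (p x) = x" if "x \<in> F" for x
    unfolding p_def[of "p x"]
    by (rule the1_equality[OF ex1]) (use p[OF that] sym[of x "p x"] that in auto)
  have "sum f F = (\<Sum>x\<in>F. f (p x))"
    by (rule sum.reindex_bij_witness[of _ p p]) (use p pp in auto)
  also have "\<dots> = (\<Sum>x\<in>F. - f x)"
    by (rule sum.cong) (use p anti in auto)
  finally show ?thesis by (simp add: sum_negf)
qed

section \<open>Finite elements on a closed simplex\<close>

lemma closure_cell: "closure (cell M j) = convex hull (range (verts M j))"
  unfolding cell_def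
  by (simp add: convex_closure_rel_interior finite_imp_compact_convex_hull compact_imp_closed)

lemma verts_in_closure_cell: "verts M j k \<in> closure (cell M j)"
  by (simp add: closure_cell hull_inc)

lemma closure_cell_subset_surface: "j < nsimps M \<Longrightarrow> closure (cell M j) \<subseteq> surface M"
  by (auto simp: surface_def)

text \<open>
  By continuity the affine formula extends from the open simplex to its vertices, where the nodal
  data of the scheme live.
\<close>

lemma Vh_affine_on_closure:
  assumes "\<phi> \<in> Vh M" "j < nsimps M"
  obtains a b where "\<And>p. p \<in> closure (cell M j) \<Longrightarrow> \<phi> p = a \<bullet> p + b"
proof -
  obtain a b where ab: "\<forall>p\<in>cell M j. \<phi> p = a \<bullet> p + b"
    using assms unfolding Vh_def by blast
  have "continuous_on (closure (cell M j)) \<phi>"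
    using assms by (intro continuous_on_subset[OF _ closure_cell_subset_surface]) (auto simp: Vh_def)
  then have "continuous_on (closure (cell M j)) (\<lambda>p. \<phi> p - (a \<bullet> p + b))"
    by (intro continuous_intros)
  then have "\<phi> p - (a \<bullet> p + b) = 0" if "p \<in> closure (cell M j)" for p
    by (rule continuous_constant_on_closure) (use ab that in auto)
  then show thesis by (intro that[of a b]) simp
qed

lemma Vh_convex_combination:
  assumes "\<phi> \<in> Vh M" "j < nsimps M" "\<And>k. 0 \<le> u k" "sum u UNIV = 1"
  shows "\<phi> (\<Sum>k\<in>UNIV. u k *\<^sub>R verts M j k) = (\<Sum>k\<in>UNIV. u k * \<phi> (verts M j k))"
proof -
  obtain a b where ab: "\<And>p. p \<in> closure (cell M j) \<Longrightarrow> \<phi> p = a \<bullet> p + b"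
    using Vh_affine_on_closure[OF assms(1,2)] by metis
  have "(\<Sum>k\<in>UNIV. u k *\<^sub>R verts M j k) \<in> closure (cell M j)"
    unfolding closure_cell by (rule convex_sum) (use assms in \<open>auto intro: hull_inc\<close>)
  then have "\<phi> (\<Sum>k\<in>UNIV. u k *\<^sub>R verts M j k) = (\<Sum>k\<in>UNIV. u k * (a \<bullet> verts M j k)) + b * sum u UNIV"
    by (simp add: ab inner_sum_right assms)
  also have "\<dots> = (\<Sum>k\<in>UNIV. u k * \<phi> (verts M j k))"
    by (simp add: ab verts_in_closure_cell sum_distrib_left sum.distrib[symmetric] algebra_simps)
  finally show ?thesis .
qed

lemma continuous_on_Vh_vec:
  assumes "\<eta> \<in> Vh_vec M"
  shows "continuous_on (surface M) \<eta>"
proof -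
  have "continuous_on (surface M) (\<lambda>p. \<chi> i. \<eta> p $ i)"
    by (rule continuous_on_vec_lambda) (use assms in \<open>simp add: Vh_vec_def Vh_def\<close>)
  then show ?thesis by simp
qed

text \<open>
  Barycentric coordinates indexed by the vertex numbers rather than by the points, so that they can
  be transported to another mesh with the same connectivity.
\<close>

lemma in_closure_cellE:
  assumes "p \<in> closure (cell M j)"
  obtains u where "\<And>k. 0 \<le> u k" "sum u UNIV = 1" "p = (\<Sum>k\<in>UNIV. u k *\<^sub>R verts M j k)"
proof -
  have "convex hull (range (verts M j)) \<subseteq>
      {p. \<exists>u. (\<forall>k. 0 \<le> u k) \<and> sum u UNIV = 1 \<and> p = (\<Sum>k\<in>UNIV. u k *\<^sub>R verts M j k)}" (is "_ \<subseteq> ?S")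
  proof (rule hull_minimal)
    show "range (verts M j) \<subseteq> ?S"
    proof safe
      fix k
      have "verts M j k = (\<Sum>i\<in>UNIV. (if i = k then 1 else 0) *\<^sub>R verts M j i)"
        by (simp add: if_distrib[of "\<lambda>a. a *\<^sub>R _"] cong: if_cong)
      then show "\<exists>u. (\<forall>k. 0 \<le> u k) \<and> sum u UNIV = 1 \<and> verts M j k = (\<Sum>i\<in>UNIV. u i *\<^sub>R verts M j i)"
        by (intro exI[of _ "\<lambda>i. if i = k then 1 else 0"]) simp
    qed
    show "convex ?S"
    proof (rule convexI)
      fix x y and s t :: real
      assume "x \<in> ?S" "y \<in> ?S" and st: "0 \<le> s" "0 \<le> t" "s + t = 1"
      then obtain a b where "\<forall>k. 0 \<le> a k" "sum a UNIV = 1" "x = (\<Sum>k\<in>UNIV. a k *\<^sub>R verts M j k)"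
        "\<forall>k. 0 \<le> b k" "sum b UNIV = 1" "y = (\<Sum>k\<in>UNIV. b k *\<^sub>R verts M j k)"
        by auto
      then show "s *\<^sub>R x + t *\<^sub>R y \<in> ?S"
        using st by (intro CollectI exI[of _ "\<lambda>k. s * a k + t * b k"])
          (simp add: sum.distrib sum_distrib_left[symmetric] scaleR_add_left scaleR_sum_right)
    qed
  qed
  then show thesis using assms that unfolding closure_cell by blast
qed

text \<open>
  The pullback is affine on each closed simplex and sends its vertices to the corresponding vertices
  of the old simplex; it therefore preserves barycentric coordinates.
\<close>

lemma velocity_pullback_in_surface:
  assumes vidx: "nsimps Mold = nsimps M" "vidx Mold = vidx M"
    and W: "W \<in> Vh_vec M"
    and vert: "\<And>j k. j < nsimps M \<Longrightarrow> verts M j k - t *\<^sub>R W (verts M j k) = verts Mold j k"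
    and p: "p \<in> surface M"
  shows "p - t *\<^sub>R W p \<in> surface Mold"
proof -
  obtain j where j: "j < nsimps M" "p \<in> closure (cell M j)"
    using p by (auto simp: surface_def)
  obtain u where u: "\<And>k. 0 \<le> u k" "sum u UNIV = 1" and pu: "p = (\<Sum>k\<in>UNIV. u k *\<^sub>R verts M j k)"
    using in_closure_cellE[OF j(2)] by metis
  have "W p $ i = (\<Sum>k\<in>UNIV. u k *\<^sub>R W (verts M j k)) $ i" for i
    using Vh_convex_combination[of "\<lambda>p. W p $ i" M j u] W j u
    by (simp add: pu Vh_vec_def)
  then have "W p = (\<Sum>k\<in>UNIV. u k *\<^sub>R W (verts M j k))"
    by (simp add: vec_eq_iff)
  then have "p - t *\<^sub>R W p = (\<Sum>k\<in>UNIV. u k *\<^sub>R (verts M j k - t *\<^sub>R W (verts M j k)))"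
    by (simp add: pu scaleR_sum_right sum_subtractf algebra_simps)
  also have "\<dots> = (\<Sum>k\<in>UNIV. u k *\<^sub>R verts Mold j k)"
    by (simp add: vert[OF j(1)])
  also have "\<dots> \<in> closure (cell Mold j)"
    unfolding closure_cell by (rule convex_sum) (use u in \<open>auto intro: hull_inc\<close>)
  finally show ?thesis
    using closure_cell_subset_surface[of j Mold] j(1) vidx by auto
qed

section \<open>Schemes with exact geometric identities\<close>

text \<open>
  The two dimensions share the whole argument below. What distinguishes them is collected here: the
  integral of a constant over a simplex, the time-averaging identity \<open>mean_normal\<close>, and the
  contribution \<open>flux v w k\<close> of the facet opposite to vertex \<open>k\<close> when it moves from \<open>v\<close> to \<open>w\<close>. The
  laws \<open>flux_local\<close> and \<open>flux_odd\<close> say that the flux is attached to the oriented facet alone, which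
  is what makes it cancel between neighbours.
\<close>

locale exact_surface_scheme = surface_scheme N Nmean sint
  for N :: "('n::finite \<Rightarrow> real^'n) \<Rightarrow> real^'n"
    and Nmean :: "('n \<Rightarrow> real^'n) \<Rightarrow> ('n \<Rightarrow> real^'n) \<Rightarrow> real^'n"
    and sint :: "('n \<Rightarrow> real^'n) \<Rightarrow> (real^'n \<Rightarrow> real) \<Rightarrow> real" +
  fixes flux :: "('n \<Rightarrow> real^'n) \<Rightarrow> ('n \<Rightarrow> real^'n) \<Rightarrow> 'n \<Rightarrow> real"
  assumes card_ge_2: "2 \<le> CARD('n)"
    and normal_nonzero: "inj v \<Longrightarrow> \<not> affine_dependent (range v) \<Longrightarrow> N v \<noteq> 0"
    and normal_orthogonal: "v k \<bullet> N v = v l \<bullet> N v"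
    and sint_const:
      "inj v \<Longrightarrow> \<not> affine_dependent (range v) \<Longrightarrow>
       (\<And>p. p \<in> rel_interior (convex hull (range v)) \<Longrightarrow> f p = a) \<Longrightarrow>
       sint v f = a * norm (N v) / fact (CARD('n) - 1)"
    and mean_normal:
      "(\<Sum>k\<in>UNIV. (w k - v k) \<bullet> Nmean v w) = w r \<bullet> N w - v r \<bullet> N v + (\<Sum>k\<in>UNIV. flux v w k)"
    and flux_local:
      "(\<And>r. r \<noteq> k \<Longrightarrow> v r = v' r \<and> w r = w' r) \<Longrightarrow> flux v w k = flux v' w' k"
    and flux_odd:
      "\<pi> permutes UNIV \<Longrightarrow> \<not> evenperm \<pi> \<Longrightarrow> flux (v \<circ> \<pi>) (w \<circ> \<pi>) k = - flux v w (\<pi> k)"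
begin

text \<open>
  Facets are encoded as pairs of a simplex \<open>j\<close> and the opposite vertex \<open>k\<close>. Each is shared with
  exactly one other simplex, and matching the vertices along it, with \<open>k\<close> sent to the vertex opposite
  on the other side, gives a permutation. Coherence makes it odd, so the two fluxes are opposite.
  The functions \<open>P\<close> and \<open>Q\<close> on vertex indices are the old and the new positions.
\<close>

lemma flux_sum_zero:
  fixes M :: "'n mesh" and P Q :: "nat \<Rightarrow> real^'n"
  assumes inj: "\<And>j. j < nsimps M \<Longrightarrow> inj (vidx M j)"
    and bl: "boundaryless M" and co: "coherent M"
  shows "(\<Sum>j<nsimps M. \<Sum>k\<in>UNIV. flux (P \<circ> vidx M j) (Q \<circ> vidx M j) k) = 0"
proof -
  define F where "F = {..<nsimps M} \<times> (UNIV :: 'n set)"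
  define R where "R x y \<longleftrightarrow> fst x \<noteq> fst y \<and>
      vidx M (fst x) ` (- {snd x}) = vidx M (fst y) ` (- {snd y})" for x y :: "nat \<times> 'n"
  define f where "f x = flux (P \<circ> vidx M (fst x)) (Q \<circ> vidx M (fst x)) (snd x)" for x :: "nat \<times> 'n"
  have "sum f F = 0"
  proof (rule sum_eq_zero_of_pairing[of F R f])
    show "finite F" by (simp add: F_def)
  next
    fix x assume "x \<in> F"
    then obtain j k where x: "x = (j, k)" and j: "j < nsimps M" by (auto simp: F_def)
    let ?B = "vidx M j ` (- {k})"
    obtain i where i: "i < nsimps M" "i \<noteq> j" "?B \<subseteq> range (vidx M i)"
      and uniq: "\<And>i'. i' < nsimps M \<Longrightarrow> i' \<noteq> j \<Longrightarrow> ?B \<subseteq> range (vidx M i') \<Longrightarrow> i' = i"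
      using bl j unfolding boundaryless_def by metis
    \<comment> \<open>A facet has one vertex less than the neighbour containing it: the missing one is \<open>k'\<close>.\<close>
    have cB: "card ?B = CARD('n) - 1"
      using inj[OF j] by (simp add: card_image inj_on_subset Compl_eq_Diff_UNIV card_Diff_singleton)
    have "card (range (vidx M i) - ?B) = CARD('n) - (CARD('n) - 1)"
      using i(3) inj[OF i(1)] cB by (simp add: card_Diff_subset card_image)
    then have "card (range (vidx M i) - ?B) = 1"
      using card_ge_2 by simp
    then obtain y where y: "range (vidx M i) - ?B = {y}"
      by (auto simp: card_1_singleton_iff)
    then obtain k' where k': "y = vidx M i k'" by blast
    have "vidx M i ` (- {k'}) = range (vidx M i) - {y}"
      using inj[OF i(1)] by (auto simp: k' inj_def)
    also have "\<dots> = ?B"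
      unfolding y[symmetric] using i(3) by (rule double_diff) simp
    finally have B: "vidx M i ` (- {k'}) = ?B" .
    show "\<exists>!y. y \<in> F \<and> R x y"
    proof (rule ex1I[of _ "(i, k')"])
      show "(i, k') \<in> F \<and> R x (i, k')"
        using i B by (simp add: F_def R_def x)
    next
      fix z assume z: "z \<in> F \<and> R x z"
      obtain i' k'' where zz: "z = (i', k'')" by fastforce
      have "i' = i"
        using z uniq[of i'] by (auto simp: zz F_def R_def x)
      moreover have "k'' = k'"
      proof -
        have "vidx M i ` (- {k''}) = vidx M i ` (- {k'})"
          using z B \<open>i' = i\<close> by (simp add: zz R_def x)
        then have "- {k''} = - {k'}"
          by (simp only: inj_image_eq_iff[OF inj[OF i(1)]])
        then show ?thesis by simp
      qed
      ultimately show "z = (i, k')" by (simp add: zz)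
    qed
  next
    fix x y assume "R x y" then show "R y x" by (auto simp: R_def)
  next
    fix x y assume "x \<in> F" "y \<in> F" "R x y"
    then obtain j k i k' where x: "x = (j, k)" and y: "y = (i, k')" and
      ij: "j < nsimps M" "i < nsimps M" "i \<noteq> j" and
      B: "vidx M j ` (- {k}) = vidx M i ` (- {k'})"
      by (auto simp: F_def R_def)
    \<comment> \<open>Matches the vertices of \<open>j\<close> to those of \<open>i\<close> along the common facet.\<close>
    define \<pi> where "\<pi> r = (if r = k then k' else inv (vidx M i) (vidx M j r))" for r
    have \<pi>: "\<pi> r \<noteq> k' \<and> vidx M i (\<pi> r) = vidx M j r" if "r \<noteq> k" for r
    proof -
      have "vidx M j r \<in> vidx M i ` (- {k'})" using B that by blast
      then obtain s where "s \<noteq> k'" "vidx M j r = vidx M i s" by blast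
      then show ?thesis using inj[OF ij(2)] that by (simp add: \<pi>_def inv_f_f)
    qed
    have \<pi>k: "\<pi> k = k'" by (simp add: \<pi>_def)
    have "inj \<pi>"
    proof (rule injI)
      fix r s assume "\<pi> r = \<pi> s"
      then show "r = s"
        using \<pi>[of r] \<pi>[of s] \<pi>k injD[OF inj[OF ij(1)], of r s] by metis
    qed
    then have perm: "\<pi> permutes UNIV"
      by (intro bij_imp_permutes) (simp_all add: bij_def finite_UNIV_inj_surj)
    have odd: "\<not> evenperm \<pi>"
      using co ij perm \<pi> unfolding coherent_def by blast
    have "f x = flux ((P \<circ> vidx M i) \<circ> \<pi>) ((Q \<circ> vidx M i) \<circ> \<pi>) k"
      unfolding f_def x by (simp, rule flux_local) (use \<pi> in auto)
    also have "\<dots> = - f y"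
      by (simp only: flux_odd[OF perm odd] f_def y fst_conv snd_conv \<pi>k)
    finally show "f y = - f x" by simp
  qed
  then show ?thesis
    by (simp add: F_def f_def sum.cartesian_product case_prod_unfold)
qed

lemma conforming_verts:
  assumes "conforming M" "j < nsimps M"
  shows "inj (vidx M j)" "inj (verts M j)" "\<not> affine_dependent (range (verts M j))"
    "N (verts M j) \<noteq> 0"
proof -
  show 1: "inj (vidx M j)" and 3: "\<not> affine_dependent (range (verts M j))"
    using assms by (auto simp: conforming_def)
  have "range (vidx M j) \<subseteq> {..<nverts M}" "inj_on (vert M) {..<nverts M}"
    using assms by (auto simp: conforming_def)
  then have "inj_on (vert M) (range (vidx M j))" using inj_on_subset by blast
  then show 2: "inj (verts M j)"
    using comp_inj_on[OF 1, of "vert M"] by (simp add: comp_def verts_def[abs_def])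
  show "N (verts M j) \<noteq> 0" using normal_nonzero[OF 2 3] .
qed

lemma elem_eq:
  assumes "conforming M" "j < nsimps M" "p \<in> cell M j"
  shows "elem M p = j"
proof -
  have "i = j" if "i < nsimps M" "p \<in> cell M i" for i
  proof (rule ccontr)
    assume "i \<noteq> j"
    then have "cell M i \<inter> cell M j = {}" using assms that by (simp add: conforming_def)
    then show False using assms that by blast
  qed
  then show ?thesis
    unfolding elem_def by (intro the_equality conjI assms) simp_all
qed

text \<open>
  On a flat simplex \<open>p \<bullet> N\<close> is constant, so the volume is a sum of signed volumes of cones with apex
  at the origin; any vertex \<open>r\<close> can be used to evaluate the constant.
\<close>

lemma vol_eq_sum:
  assumes "conforming M"
  shows "vol M = (\<Sum>j<nsimps M. verts M j r \<bullet> N (verts M j)) / fact CARD('n)"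
proof -
  have "sint (verts M j) (\<lambda>p. p \<bullet> unit_normal M p)
      = verts M j r \<bullet> N (verts M j) / fact (CARD('n) - 1)" if j: "j < nsimps M" for j
  proof -
    let ?n = "N (verts M j)"
    note v = conforming_verts[OF assms j]
    have hyperplane: "convex hull (range (verts M j)) \<subseteq> {p. ?n \<bullet> p = ?n \<bullet> verts M j r}"
      using normal_orthogonal[of "verts M j" _ r]
      by (intro hull_minimal convex_hyperplane) (auto simp: inner_commute)
    have "p \<bullet> unit_normal M p = (verts M j r \<bullet> ?n) / norm ?n"
      if "p \<in> rel_interior (convex hull (range (verts M j)))" for p
    proof -
      have "p \<bullet> ?n = verts M j r \<bullet> ?n"
        using hyperplane that rel_interior_subset by (fastforce simp: inner_commute)
      moreover have "elem M p = j"
        using elem_eq[OF assms j] that by (simp add: cell_def)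
      ultimately show ?thesis by (simp add: unit_normal_def Let_def divide_inverse)
    qed
    then show ?thesis
      using sint_const[OF v(2,3)] v(4) by simp
  qed
  then have "vol M = 1 / real CARD('n) *
      ((\<Sum>j<nsimps M. verts M j r \<bullet> N (verts M j)) / fact (CARD('n) - 1))"
    by (simp add: vol_def surf_int_def sum_divide_distrib)
  also have "\<dots> = (\<Sum>j<nsimps M. verts M j r \<bullet> N (verts M j)) / fact CARD('n)"
    using card_ge_2 by (simp add: fact_reduce[of "CARD('n)"])
  finally show ?thesis .
qed

text \<open>
  A nondegenerate open simplex of positive dimension accumulates at its vertices, so the one-sided
  vertex limits in the mass-lumped product are uniquely determined.
\<close>

lemma vertex_limit_nontrivial:
  assumes "conforming M" "j < nsimps M"
  shows "\<not> trivial_limit (at (verts M j k) within cell M j)"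
proof -
  obtain l where "l \<noteq> k"
    using card_ge_2 by (metis (full_types) UNIV_eq_I card_1_singleton_iff One_nat_def insertCI
        numeral_le_one_iff semiring_norm(69) singleton_iff)
  then have ne: "verts M j l \<noteq> verts M j k"
    using conforming_verts(2)[OF assms] by (auto dest: injD)
  have "verts M j k islimpt cell M j"
  proof (cases "verts M j k \<in> cell M j")
    case True
    have "connected (cell M j)"
      by (simp add: cell_def convex_connected convex_rel_interior)
    moreover have "cell M j \<noteq> {x}" for x
    proof
      assume "cell M j = {x}"
      then have "closure (cell M j) = {x}" by simp
      then show False
        using verts_in_closure_cell[of M j l] verts_in_closure_cell[of M j k] ne by simp
    qed
    ultimately show ?thesis using True by (intro connected_imp_perfect)
  next
    case False
    have "verts M j k \<in> cell M j \<union> {x. x islimpt cell M j}"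
      using verts_in_closure_cell[of M j k] unfolding closure_def .
    then show ?thesis using False by simp
  qed
  then show ?thesis by (simp add: trivial_limit_within)
qed

text \<open>
  If on every open simplex the integrand agrees with a function \<open>g j\<close> continuous up to the boundary,
  its vertex limits are the values of \<open>g j\<close>. All uses of linearity of the product go through this
  formula.
\<close>

lemma iph_eq:
  assumes "conforming M"
    and g: "\<And>j. j < nsimps M \<Longrightarrow> continuous_on (closure (cell M j)) (g j)"
    and eq: "\<And>j p. j < nsimps M \<Longrightarrow> p \<in> cell M j \<Longrightarrow> u p \<bullet> v p = g j p"
  shows "iph M u v = 1 / real CARD('n) *
      (\<Sum>j<nsimps M. simplex_measure M j * (\<Sum>k\<in>UNIV. g j (verts M j k)))"
proof -
  have "Lim (at (verts M j k) within cell M j) (\<lambda>p. u p \<bullet> v p) = g j (verts M j k)"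
    if j: "j < nsimps M" for j k
  proof (rule tendsto_Lim[OF vertex_limit_nontrivial[OF assms(1) j]])
    have "(g j \<longlongrightarrow> g j (verts M j k)) (at (verts M j k) within closure (cell M j))"
      using g[OF j] verts_in_closure_cell by (auto simp: continuous_on_def)
    then have "(g j \<longlongrightarrow> g j (verts M j k)) (at (verts M j k) within cell M j)"
      by (rule tendsto_within_subset) (rule closure_subset)
    then show "((\<lambda>p. u p \<bullet> v p) \<longlongrightarrow> g j (verts M j k)) (at (verts M j k) within cell M j)"
      by (rule Lim_transform_eventually) (use eq[OF j] in \<open>auto simp: eventually_at_filter\<close>)
  qed
  then show ?thesis by (simp add: iph_def)
qed

lemma iph_deviation_from_mean:
  assumes conf: "conforming M" and ne: "0 < nsimps M" and cont: "continuous_on (surface M) \<kappa>"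
  shows "iph M (\<lambda>p. \<kappa> p - iph M \<kappa> (\<lambda>p. 1) / iph M (\<lambda>p. 1 :: real) (\<lambda>p. 1)) (\<lambda>p. 1) = 0"
proof -
  have c: "continuous_on (closure (cell M j)) \<kappa>" if "j < nsimps M" for j
    by (rule continuous_on_subset[OF cont closure_cell_subset_surface[OF that]])
  define m where "m = (\<Sum>j<nsimps M. simplex_measure M j)"
  define s where "s = (\<Sum>j<nsimps M. simplex_measure M j * (\<Sum>k\<in>UNIV. \<kappa> (verts M j k)))"
  have "0 < simplex_measure M j" if "j < nsimps M" for j
    using conforming_verts(4)[OF conf that] by (simp add: simplex_measure_def)
  then have m: "0 < m"
    unfolding m_def using ne by (intro sum_pos) auto
  have d: "real CARD('n) \<noteq> 0" using card_ge_2 by simp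
  have one: "iph M (\<lambda>p. 1 :: real) (\<lambda>p. 1) = m"
    using iph_eq[OF conf, of "\<lambda>j p. 1" "\<lambda>p. 1 :: real" "\<lambda>p. 1"]
    by (simp add: m_def sum_distrib_right[symmetric])
  have k: "iph M \<kappa> (\<lambda>p. 1) = s / CARD('n)"
    using iph_eq[OF conf c, of \<kappa> "\<lambda>p. 1"] by (simp add: s_def)
  have "iph M (\<lambda>p. \<kappa> p - b) (\<lambda>p. 1) = s / CARD('n) - m * b" for b
  proof -
    have "iph M (\<lambda>p. \<kappa> p - b) (\<lambda>p. 1) = 1 / real CARD('n) *
        (\<Sum>j<nsimps M. simplex_measure M j * (\<Sum>k\<in>UNIV. \<kappa> (verts M j k) - b))"
      using iph_eq[OF conf, of "\<lambda>j p. \<kappa> p - b" "\<lambda>p. \<kappa> p - b" "\<lambda>p. 1"] c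
      by (simp add: continuous_intros)
    also have "\<dots> = 1 / real CARD('n) * (s - m * (CARD('n) * b))"
      by (simp add: s_def m_def sum_subtractf right_diff_distrib sum_distrib_right)
    also have "\<dots> = s / CARD('n) - m * b" using d by (simp add: field_simps)
    finally show ?thesis .
  qed
  then show ?thesis using m by (simp add: one k)
qed

text \<open>
  The weighted normal is constant on each simplex, and its denominator cancels against the measure of
  the simplex, which leaves the undivided mean normals.
\<close>

lemma iph_displacement:
  assumes conf: "conforming M" and X: "X \<in> Vh_vec M"
  shows "iph M (\<lambda>p. ((X p - p) /\<^sub>R t) \<bullet> weighted_normal M X p) (\<lambda>p. 1)
     = (\<Sum>j<nsimps M. \<Sum>k\<in>UNIV.
          (verts (move X M) j k - verts M j k) \<bullet> Nmean (verts M j) (verts (move X M) j))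
       / (t * fact CARD('n))"
proof -
  let ?w = "verts (move X M)"
  have w: "?w j = (\<lambda>k. X (verts M j k))" for j
    by (simp add: verts_def move_def fun_eq_iff)
  define n where "n j = Nmean (verts M j) (?w j)" for j
  define g where "g j p = ((X p - p) /\<^sub>R t) \<bullet> (n j /\<^sub>R norm (N (verts M j)))" for j p
  have "continuous_on (closure (cell M j)) (g j)" if "j < nsimps M" for j
    using continuous_on_subset[OF continuous_on_Vh_vec[OF X] closure_cell_subset_surface[OF that]]
    unfolding g_def by (intro continuous_intros)
  moreover have "(((X p - p) /\<^sub>R t) \<bullet> weighted_normal M X p) \<bullet> 1 = g j p"
    if "j < nsimps M" "p \<in> cell M j" for j p
    by (simp add: weighted_normal_def elem_eq[OF conf that] g_def n_def w Let_def)
  ultimately have "iph M (\<lambda>p. ((X p - p) /\<^sub>R t) \<bullet> weighted_normal M X p) (\<lambda>p. 1) =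
      1 / real CARD('n) * (\<Sum>j<nsimps M. simplex_measure M j * (\<Sum>k\<in>UNIV. g j (verts M j k)))"
    by (rule iph_eq[OF conf])
  also have "(\<Sum>j<nsimps M. simplex_measure M j * (\<Sum>k\<in>UNIV. g j (verts M j k)))
    = (\<Sum>j<nsimps M. (\<Sum>k\<in>UNIV. (?w j k - verts M j k) \<bullet> n j) / (t * fact (CARD('n) - 1)))"
  proof (rule sum.cong[OF refl])
    fix j assume "j \<in> {..<nsimps M}"
    then have "norm (N (verts M j)) \<noteq> 0" using conforming_verts(4)[OF conf] by simp
    then have "simplex_measure M j * g j (verts M j k)
        = (?w j k - verts M j k) \<bullet> n j / (t * fact (CARD('n) - 1))" for k
      by (simp add: simplex_measure_def g_def w divide_simps)
    then show "simplex_measure M j * (\<Sum>k\<in>UNIV. g j (verts M j k))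
        = (\<Sum>k\<in>UNIV. (?w j k - verts M j k) \<bullet> n j) / (t * fact (CARD('n) - 1))"
      by (simp add: sum_distrib_left sum_divide_distrib)
  qed
  finally show ?thesis
    using card_ge_2 by (simp add: n_def fact_reduce[of "CARD('n)"] sum_divide_distrib[symmetric] mult_ac)
qed

text \<open>
  One step of the scheme. The displacement sum vanishes by testing with \<open>1\<close> and the fluxes cancel, so
  summing \<open>mean_normal\<close> over all simplices leaves only the difference of the two volumes.
\<close>

lemma volume_conservation:
  assumes M: "polyhedral_surface M" and M': "polyhedral_surface (move X M)"
    and t: "0 < t" and V: "ip M V (\<lambda>p. 1) = 0"
    and \<kappa>: "continuous_on (surface M) \<kappa>"
    and st: "second_stage t M\<^sub>0 M V \<kappa> X \<kappa>' \<alpha>"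
  shows "vol (move X M) = vol M"
proof -
  let ?w = "verts (move X M)"
  have conf: "conforming M" "conforming (move X M)" and ne: "0 < nsimps M"
    and bl: "boundaryless M" and co: "coherent M"
    using M M' by (auto simp: polyhedral_surface_def)
  have X: "X \<in> Vh_vec M" using st by (simp add: second_stage_def)
  have one: "(\<lambda>p. 1) \<in> Vh M"
    by (auto simp: Vh_def intro!: exI[of _ "0 :: real^'n"])
  have "iph M (\<lambda>p. ((X p - p) /\<^sub>R t) \<bullet> weighted_normal M X p) (\<lambda>p. 1) = 0"
    using st one V iph_deviation_from_mean[OF conf(1) ne \<kappa>] by (simp add: second_stage_def)
  then have "(\<Sum>j<nsimps M. \<Sum>k\<in>UNIV. (?w j k - verts M j k) \<bullet> Nmean (verts M j) (?w j)) = 0"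
    using t unfolding iph_displacement[OF conf(1) X] by simp
  moreover have "(\<Sum>j<nsimps M. \<Sum>k\<in>UNIV. flux (verts M j) (?w j) k) = 0"
  proof -
    have "verts M j = vert M \<circ> vidx M j" "?w j = vert (move X M) \<circ> vidx M j" for j
      by (simp_all add: verts_def move_def fun_eq_iff)
    then show ?thesis
      using flux_sum_zero[OF conforming_verts(1)[OF conf(1)] bl co] by simp
  qed
  ultimately have "(\<Sum>j<nsimps M. ?w j r \<bullet> N (?w j)) = (\<Sum>j<nsimps M. verts M j r \<bullet> N (verts M j))" for r
    by (simp add: mean_normal[of _ _ r] sum.distrib sum_subtractf)
  moreover have "nsimps (move X M) = nsimps M" by (simp add: move_def)
  \<comment> \<open>Any vertex of reference will do, as long as it is the same for both volumes.\<close>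
  ultimately show ?thesis
    by (simp add: vol_eq_sum[OF conf(1), of undefined] vol_eq_sum[OF conf(2), of undefined])
qed

text \<open>
  The volume part rests on the continuity of the pulled back \<open>\<kappa>\<close>. For \<open>m = 0\<close> the velocity vanishes at the
  vertices, so the pullback is the identity of the surface, which matches the convention that \<open>\<Gamma> 0\<close> is its own
  predecessor.
\<close>

theorem two_stage_conservation:
  assumes t: "0 < t" and ev: "two_stage_evolution t c\<^sub>0 \<Gamma> V c l \<mu> X \<kappa> \<alpha>"
  shows "vol (\<Gamma> (Suc m)) = vol (\<Gamma> m)" "area (\<Gamma> (Suc m)) = area (\<Gamma> m)"
proof -
  have poly: "polyhedral_surface (\<Gamma> m)" and step: "\<Gamma> (Suc m) = move (X (Suc m)) (\<Gamma> m)" for m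
    using ev by (auto simp: two_stage_evolution_def)
  have stages: "\<exists>W J w. is_mesh_velocity t (\<Gamma> (m - 1)) (\<Gamma> m) W \<and>
      first_stage t c\<^sub>0 (\<Gamma> m) W J w (c m \<circ> (\<lambda>p. p - t *\<^sub>R W p)) (\<kappa> m \<circ> (\<lambda>p. p - t *\<^sub>R W p))
        (V (Suc m)) (c (Suc m)) (l (Suc m)) (\<mu> (Suc m)) \<and>
      second_stage t (\<Gamma> 0) (\<Gamma> m) (V (Suc m)) (\<kappa> m \<circ> (\<lambda>p. p - t *\<^sub>R W p))
        (X (Suc m)) (\<kappa> (Suc m)) (\<alpha> (Suc m))" for m
    using ev unfolding two_stage_evolution_def Let_def by blast
  have area0: "area (\<Gamma> m) = area (\<Gamma> 0)" for m
  proof (cases m)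
    case (Suc n)
    then show ?thesis using stages[of n] step[of n] by (auto simp: second_stage_def)
  qed simp
  show "area (\<Gamma> (Suc m)) = area (\<Gamma> m)" using area0[of m] area0[of "Suc m"] by simp
  have kappa: "\<kappa> m \<in> Vh (\<Gamma> (m - 1))"
  proof (cases m)
    case 0
    then show ?thesis using ev by (simp add: two_stage_evolution_def)
  next
    case (Suc n)
    then show ?thesis using stages[of n] by (auto simp: second_stage_def)
  qed
  have same: "nsimps (\<Gamma> (m - 1)) = nsimps (\<Gamma> m)" "vidx (\<Gamma> (m - 1)) = vidx (\<Gamma> m)"
    using step[of "m - 1"] by (cases m; simp add: move_def)+
  obtain W J w where W: "is_mesh_velocity t (\<Gamma> (m - 1)) (\<Gamma> m) W"
    and s1: "first_stage t c\<^sub>0 (\<Gamma> m) W J w (c m \<circ> (\<lambda>p. p - t *\<^sub>R W p)) (\<kappa> m \<circ> (\<lambda>p. p - t *\<^sub>R W p))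
        (V (Suc m)) (c (Suc m)) (l (Suc m)) (\<mu> (Suc m))"
    and s2: "second_stage t (\<Gamma> 0) (\<Gamma> m) (V (Suc m)) (\<kappa> m \<circ> (\<lambda>p. p - t *\<^sub>R W p))
        (X (Suc m)) (\<kappa> (Suc m)) (\<alpha> (Suc m))"
    using stages[of m] by blast
  have WV: "W \<in> Vh_vec (\<Gamma> m)" using W by (simp add: is_mesh_velocity_def)
  have "verts (\<Gamma> m) j k - t *\<^sub>R W (verts (\<Gamma> m) j k) = verts (\<Gamma> (m - 1)) j k"
    if "j < nsimps (\<Gamma> m)" for j k
  proof -
    have "vidx (\<Gamma> m) j k < nverts (\<Gamma> m)"
      using poly[of m] that by (auto simp: polyhedral_surface_def conforming_def)
    then have "W (verts (\<Gamma> m) j k) = (verts (\<Gamma> m) j k - verts (\<Gamma> (m - 1)) j k) /\<^sub>R t"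
      using W same by (simp add: is_mesh_velocity_def verts_def)
    then show ?thesis using t by simp
  qed
  then have img: "(\<lambda>p. p - t *\<^sub>R W p) ` surface (\<Gamma> m) \<subseteq> surface (\<Gamma> (m - 1))"
    using velocity_pullback_in_surface[OF same WV] by blast
  have "continuous_on (surface (\<Gamma> m)) (\<lambda>p. p - t *\<^sub>R W p)"
    by (intro continuous_intros continuous_on_Vh_vec[OF WV])
  moreover have "continuous_on ((\<lambda>p. p - t *\<^sub>R W p) ` surface (\<Gamma> m)) (\<kappa> m)"
    using kappa by (intro continuous_on_subset[OF _ img]) (simp add: Vh_def)
  ultimately have "continuous_on (surface (\<Gamma> m)) (\<kappa> m \<circ> (\<lambda>p. p - t *\<^sub>R W p))"
    by (rule continuous_on_compose)
  moreover have "ip (\<Gamma> m) (V (Suc m)) (\<lambda>p. 1) = 0"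
    using s1 by (simp add: first_stage_def)
  ultimately show "vol (\<Gamma> (Suc m)) = vol (\<Gamma> m)"
    using volume_conservation[OF poly[of m] _ t _ _ s2] poly[of "Suc m"] by (simp add: step)
qed

end

section \<open>Barycentric points of open simplices\<close>

text \<open>
  The parametrizations of the surface integrals run through the relative interior of the simplex,
  where elementwise quantities are well defined.
\<close>

lemma rel_interior_simplex_point:
  fixes v :: "'n::finite \<Rightarrow> real^'m"
  assumes "inj v" "\<not> affine_dependent (range v)" "\<And>k. 0 < u k" "sum u UNIV = 1"
  shows "(\<Sum>k\<in>UNIV. u k *\<^sub>R v k) \<in> rel_interior (convex hull (range v))"
proof -
  have "sum (\<lambda>x. u (inv v x)) (range v) = 1"
    and "(\<Sum>x\<in>range v. u (inv v x) *\<^sub>R x) = (\<Sum>k\<in>UNIV. u k *\<^sub>R v k)"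
    using assms by (simp_all add: sum.reindex inv_f_f)
  then show ?thesis
    unfolding rel_interior_convex_hull_explicit[OF assms(2)]
    by (intro CollectI exI[of _ "\<lambda>x. u (inv v x)"]) (simp add: assms)
qed

section \<open>Closed curves in the plane\<close>

text \<open>
  Twice the area swept by the radius vector while its end point moves linearly from \<open>a\<close> to \<open>a'\<close>,
  counted positive clockwise.
\<close>

definition swept2 :: "real^2 \<Rightarrow> real^2 \<Rightarrow> real" where
  "swept2 a a' = 1/2 * ((a' - a) \<bullet> clockwise_rot (a + a'))"

text \<open>The facet opposite to the end point \<open>1\<close> of a segment is the end point \<open>2\<close>, and conversely.\<close>

definition flux2 :: "(2 \<Rightarrow> real^2) \<Rightarrow> (2 \<Rightarrow> real^2) \<Rightarrow> 2 \<Rightarrow> real" where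
  "flux2 v w k = (if k = 1 then swept2 (v 2) (w 2) else - swept2 (v 1) (w 1))"

lemma odd_permutation_2:
  fixes \<pi> :: "2 \<Rightarrow> 2"
  assumes "\<pi> permutes UNIV" "\<not> evenperm \<pi>"
  shows "\<pi> 1 = 2" "\<pi> 2 = 1"
proof -
  have inj: "inj \<pi>" using assms permutes_inj by blast
  have "\<pi> 1 \<noteq> 1"
  proof
    assume 1: "\<pi> 1 = 1"
    then have "\<pi> 2 = 2" using exhaust_2[of "\<pi> 2"] injD[OF inj, of 1 2] by auto
    with 1 have "\<pi> = id" by (auto simp: fun_eq_iff forall_2)
    then show False using assms by simp
  qed
  then show 1: "\<pi> 1 = 2" using exhaust_2[of "\<pi> 1"] by auto
  then show "\<pi> 2 = 1" using exhaust_2[of "\<pi> 2"] injD[OF inj, of 1 2] by auto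
qed

lemma normal2_orthogonal: "v k \<bullet> normal2 v = v 1 \<bullet> normal2 v"
  using exhaust_2[of k]
  by (auto simp: normal2_def clockwise_rot_def inner_vec_def sum_2 algebra_simps)

text \<open>
  The quadrilateral swept by the segment, together with the triangles swept by the radius vectors of
  its two end points, accounts for the change of the triangle spanned by the origin and the segment.
  As a formula it is a polynomial identity in the coordinates.
\<close>

lemma mean_normal2_identity:
  "(\<Sum>k\<in>UNIV. (w k - v k) \<bullet> mean_normal2 v w)
     = w r \<bullet> normal2 w - v r \<bullet> normal2 v + (\<Sum>k\<in>UNIV. flux2 v w k)"
  unfolding normal2_orthogonal[of _ r]
  by (simp add: sum_2 flux2_def swept2_def mean_normal2_def normal2_def clockwise_rot_def
      inner_vec_def field_simps)

lemma segment_integral_const: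
  assumes "inj v" "\<not> affine_dependent (range v)"
    and f: "\<And>p. p \<in> rel_interior (convex hull (range v)) \<Longrightarrow> f p = a"
  shows "segment_integral v f = a * norm (normal2 v) / fact (CARD(2) - 1)"
proof -
  have "f (v 1 + s *\<^sub>R (v 2 - v 1)) = a" if "s \<in> {0<..<1}" for s
  proof -
    have "v 1 + s *\<^sub>R (v 2 - v 1) = (\<Sum>k\<in>UNIV. (if k = 1 then 1 - s else s) *\<^sub>R v k)"
      by (simp add: sum_2 algebra_simps)
    also have "\<dots> \<in> rel_interior (convex hull (range v))"
      by (rule rel_interior_simplex_point[OF assms(1,2)]) (use that in \<open>auto simp: sum_2\<close>)
    finally show ?thesis by (rule f)
  qed
  then have "segment_integral v f = (LINT s:{0<..<1::real}|lborel. a * norm (v 2 - v 1))"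
    unfolding segment_integral_def by (intro set_lebesgue_integral_cong) auto
  also have "\<dots> = a * norm (v 2 - v 1)"
    by (simp add: set_integral_const)
  also have "norm (v 2 - v 1) = norm (normal2 v)"
    by (simp add: normal2_def clockwise_rot_def norm_vec_def L2_set_def sum_2 add.commute
        power2_commute[of "v 1 $ 1"])
  finally show ?thesis by simp
qed

lemma normal2_nonzero: "inj v \<Longrightarrow> normal2 v \<noteq> 0"
  using injD[of v 1 2]
  by (auto simp: normal2_def clockwise_rot_def vec_eq_iff forall_2)

lemma flux2_odd:
  assumes "\<pi> permutes UNIV" "\<not> evenperm \<pi>"
  shows "flux2 (v \<circ> \<pi>) (w \<circ> \<pi>) k = - flux2 v w (\<pi> k)"
  using exhaust_2[of k] odd_permutation_2[OF assms] by (auto simp: flux2_def)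

interpretation exact_d2: exact_surface_scheme normal2 mean_normal2 segment_integral flux2
proof
  show "2 \<le> CARD(2)" by simp
  show "normal2 v \<noteq> 0" if "inj v" for v :: "2 \<Rightarrow> real^2" using that by (rule normal2_nonzero)
  show "v k \<bullet> normal2 v = v l \<bullet> normal2 v" for v k l
    by (metis normal2_orthogonal)
  show "flux2 v w k = flux2 v' w' k"
    if "\<And>r. r \<noteq> k \<Longrightarrow> v r = v' r \<and> w r = w' r" for v w v' w' k
    using that[of 1] that[of 2] exhaust_2[of k] by (auto simp: flux2_def)
  show "segment_integral v f = a * norm (normal2 v) / fact (CARD(2) - 1)"
    if "inj v" "\<not> affine_dependent (range v)"
      "\<And>p. p \<in> rel_interior (convex hull (range v)) \<Longrightarrow> f p = a" for v f a
    using that by (rule segment_integral_const)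
  show "(\<Sum>k\<in>UNIV. (w k - v k) \<bullet> mean_normal2 v w)
      = w r \<bullet> normal2 w - v r \<bullet> normal2 v + (\<Sum>k\<in>UNIV. flux2 v w k)" for v w r
    by (rule mean_normal2_identity)
  show "flux2 (v \<circ> \<pi>) (w \<circ> \<pi>) k = - flux2 v w (\<pi> k)"
    if "\<pi> permutes UNIV" "\<not> evenperm \<pi>" for \<pi> v w k
    using that by (rule flux2_odd)
qed

section \<open>Closed surfaces in space\<close>

text \<open>
  Six times the signed volume swept by the triangle \<open>0, a, b\<close> while its edge moves linearly to
  \<open>a', b'\<close>, that is, the time integral of \<open>(\<partial>a + \<partial>b) \<bullet> (a \<times> b)\<close> by Simpson's rule, with \<open>\<partial>\<close> the
  time derivative. The factor \<open>4\<close> of the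
  midpoint is absorbed by the two halves in the midpoint vectors.
\<close>

definition swept3 :: "real^3 \<Rightarrow> real^3 \<Rightarrow> real^3 \<Rightarrow> real^3 \<Rightarrow> real" where
  "swept3 a b a' b' = 1/6 * (((a' - a) + (b' - b)) \<bullet>
     (cross3 a b + cross3 (a + a') (b + b') + cross3 a' b'))"

definition flux3 :: "(3 \<Rightarrow> real^3) \<Rightarrow> (3 \<Rightarrow> real^3) \<Rightarrow> 3 \<Rightarrow> real" where
  "flux3 v w k = (if k = 1 then swept3 (v 2) (v 3) (w 2) (w 3)
     else if k = 2 then swept3 (v 3) (v 1) (w 3) (w 1) else swept3 (v 1) (v 2) (w 1) (w 2))"

lemma swept3_swap: "swept3 b a b' a' = - swept3 a b a' b'"
  by (simp add: swept3_def cross3_def inner_vec_def sum_3 field_simps)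

text \<open>The even permutations, namely the identity and the two rotations, are excluded one by one.\<close>

lemma odd_permutation_3:
  fixes \<pi> :: "3 \<Rightarrow> 3"
  assumes "\<pi> permutes UNIV" "\<not> evenperm \<pi>"
  shows "\<pi> 1 = 1 \<and> \<pi> 2 = 3 \<and> \<pi> 3 = 2 \<or> \<pi> 1 = 2 \<and> \<pi> 2 = 1 \<and> \<pi> 3 = 3 \<or>
    \<pi> 1 = 3 \<and> \<pi> 2 = 2 \<and> \<pi> 3 = 1"
proof -
  have inj: "inj \<pi>" using assms permutes_inj by blast
  have perm: "permutation (Transposition.transpose a b)" for a b :: 3
    by (rule permutation_swap_id)
  have "\<pi> \<noteq> id" using assms by auto
  then have 0: "\<not> (\<pi> 1 = 1 \<and> \<pi> 2 = 2 \<and> \<pi> 3 = 3)"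
    by (auto simp: fun_eq_iff forall_3)
  have "\<pi> \<noteq> Transposition.transpose 1 2 \<circ> Transposition.transpose 2 3"
    using assms evenperm_comp[OF perm perm, of 1 2 2 3] by (auto simp: evenperm_swap)
  then have 1: "\<not> (\<pi> 1 = 2 \<and> \<pi> 2 = 3 \<and> \<pi> 3 = 1)"
    by (auto simp: fun_eq_iff forall_3 Transposition.transpose_def)
  have "\<pi> \<noteq> Transposition.transpose 2 3 \<circ> Transposition.transpose 1 2"
    using assms evenperm_comp[OF perm perm, of 2 3 1 2] by (auto simp: evenperm_swap)
  then have 2: "\<not> (\<pi> 1 = 3 \<and> \<pi> 2 = 1 \<and> \<pi> 3 = 2)"
    by (auto simp: fun_eq_iff forall_3 Transposition.transpose_def)
  have "\<pi> 1 \<noteq> \<pi> 2" "\<pi> 1 \<noteq> \<pi> 3" "\<pi> 2 \<noteq> \<pi> 3"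
    using inj by (auto simp: inj_eq)
  then show ?thesis
    using 0 1 2 exhaust_3[of "\<pi> 1"] exhaust_3[of "\<pi> 2"] exhaust_3[of "\<pi> 3"] by metis
qed

lemma flux3_odd:
  assumes "\<pi> permutes UNIV" "\<not> evenperm \<pi>"
  shows "flux3 (v \<circ> \<pi>) (w \<circ> \<pi>) k = - flux3 v w (\<pi> k)"
  using exhaust_3[of k] odd_permutation_3[OF assms]
  by (elim disjE conjE; simp add: flux3_def swept3_swap[of "v 3" "v 1"] swept3_swap[of "v 3" "v 2"]
      swept3_swap[of "v 2" "v 1"])

lemma normal3_orthogonal: "v k \<bullet> normal3 v = v 1 \<bullet> normal3 v"
  using exhaust_3[of k]
  by (auto simp: normal3_def cross3_def inner_vec_def sum_3 algebra_simps)

lemma normal3_eq_edge_sum: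
  "normal3 v = cross3 (v 1) (v 2) + cross3 (v 2) (v 3) + cross3 (v 3) (v 1)"
  by (simp add: normal3_def cross3_def vec_eq_iff forall_3 algebra_simps)

lemma inner_normal3: "v r \<bullet> normal3 v = v 1 \<bullet> cross3 (v 2) (v 3)"
  unfolding normal3_orthogonal[of v r]
  by (simp add: normal3_eq_edge_sum inner_add_right dot_cross_self)

text \<open>
  The increment of the determinant is the time integral of its derivative along the linear motion,
  evaluated by Simpson's rule. By trilinearity and cyclic symmetry both sides are combinations of the
  eight determinants whose columns are old or new positions.
\<close>

lemma simpson_triple_product:
  fixes a b c a' b' c' :: "real^3"
  defines "S \<equiv> \<lambda>x x' y y'. cross3 x y + cross3 (x + x') (y + y') + cross3 x' y'"
  shows "(c' - c) \<bullet> S a a' b b' + (a' - a) \<bullet> S b b' c c' + (b' - b) \<bullet> S c c' a a'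
    = 6 * (a' \<bullet> cross3 b' c' - a \<bullet> cross3 b c)"
proof -
  have cyc: "x \<bullet> cross3 y z = z \<bullet> cross3 x y" "x \<bullet> cross3 y z = y \<bullet> cross3 z x" for x y z
    by (simp_all add: cross3_def inner_vec_def sum_3 algebra_simps)
  show ?thesis
    unfolding S_def cross_add_left cross_add_right inner_add_right inner_diff_left
      cyc(1)[of b c a] cyc(1)[of b c' a] cyc(1)[of b' c a] cyc(1)[of b' c' a]
      cyc(1)[of b c a'] cyc(1)[of b c' a'] cyc(1)[of b' c a'] cyc(1)[of b' c' a']
      cyc(2)[of c a b] cyc(2)[of c' a b] cyc(2)[of c a b'] cyc(2)[of c' a b']
      cyc(2)[of c a' b] cyc(2)[of c' a' b] cyc(2)[of c a' b'] cyc(2)[of c' a' b']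
    by argo
qed

text \<open>
  With \<open>N = v\<^sub>1 \<times> v\<^sub>2 + v\<^sub>2 \<times> v\<^sub>3 + v\<^sub>3 \<times> v\<^sub>1\<close>, the nine terms of the rate \<open>(\<Sum>k. \<partial>v\<^sub>k) \<bullet> N\<close> split into the three
  that make up the derivative of the determinant of \<open>v\<^sub>1, v\<^sub>2, v\<^sub>3\<close> and two for each edge. The
  statement is the time integral of this; Simpson's rule is exact for the quadratic \<open>N\<close>.
\<close>

lemma mean_normal3_identity:
  "(\<Sum>k\<in>UNIV. (w k - v k) \<bullet> mean_normal3 v w)
     = w r \<bullet> normal3 w - v r \<bullet> normal3 v + (\<Sum>k\<in>UNIV. flux3 v w k)"
proof -
  define S where "S i j = cross3 (v i) (v j) + cross3 (v i + w i) (v j + w j) + cross3 (w i) (w j)" for i j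
  have "normal3 (\<lambda>k. (1/2) *\<^sub>R (v k + w k)) = (1/4) *\<^sub>R normal3 (\<lambda>k. v k + w k)"
    by (simp add: normal3_def cross3_def vec_eq_iff forall_3 field_simps)
  then have mean: "mean_normal3 v w = (1/6) *\<^sub>R (S 1 2 + S 2 3 + S 3 1)"
    by (simp add: mean_normal3_def normal3_eq_edge_sum S_def)
  have flux: "flux3 v w 1 = 1/6 * (((w 2 - v 2) + (w 3 - v 3)) \<bullet> S 2 3)"
    "flux3 v w 2 = 1/6 * (((w 3 - v 3) + (w 1 - v 1)) \<bullet> S 3 1)"
    "flux3 v w 3 = 1/6 * (((w 1 - v 1) + (w 2 - v 2)) \<bullet> S 1 2)"
    by (simp_all add: flux3_def swept3_def S_def)
  have "(w 3 - v 3) \<bullet> S 1 2 + (w 1 - v 1) \<bullet> S 2 3 + (w 2 - v 2) \<bullet> S 3 1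
      = 6 * (w r \<bullet> normal3 w - v r \<bullet> normal3 v)"
    unfolding inner_normal3 S_def by (rule simpson_triple_product)
  then show ?thesis
    unfolding sum_3 flux mean inner_scaleR_right inner_add_right inner_add_left by argo
qed

lemma normal3_nonzero:
  assumes "inj v" "\<not> affine_dependent (range v)"
  shows "normal3 v \<noteq> 0"
proof
  assume "normal3 v = 0"
  then have "collinear {0, v 2 - v 1, v 3 - v 1}"
    by (simp add: normal3_def cross_eq_0)
  then have "collinear {v 2, v 1, v 3}"
    by (simp add: collinear_3)
  moreover have "range v = {v 2, v 1, v 3}" by (auto simp: UNIV_3)
  ultimately show False
    using assms by (auto simp: collinear_3_eq_affine_dependent inj_eq)
qed

text \<open>
  The open reference triangle is the interior of the standard simplex, whose boundary is a null set.
\<close>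

lemma reference_triangle:
  defines "T \<equiv> {(s, t). 0 < s \<and> 0 < t \<and> s + t < (1::real)}"
  shows "T \<in> sets lborel" "measure lborel T = 1 / 2" "emeasure lborel T < \<infinity>"
proof -
  let ?S = "convex hull (insert 0 Basis) :: (real \<times> real) set"
  have T: "T = interior ?S"
    unfolding interior_std_simplex T_def by (auto simp: Basis_prod_def)
  show "T \<in> sets lborel" unfolding T by simp
  have bnd: "bounded ?S" 
    by (intro bounded_convex_hull finite_imp_bounded) simp
  then have lm: "interior ?S \<in> lmeasurable" by (simp add: bounded_interior lmeasurable_open)
  have "measure lborel T = measure lebesgue (interior ?S)"
    unfolding T by simp
  also have "\<dots> = measure lebesgue ?S"
    by (rule measure_interior[OF bnd negligible_convex_frontier]) simp
  also have "\<dots> = measure lborel ?S"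
    by (intro measure_completion) (simp add: borel_compact finite_imp_compact_convex_hull)
  also have "\<dots> = 1 / 2" by (simp add: content_std_simplex)
  finally show "measure lborel T = 1 / 2" .
  show "emeasure lborel T < \<infinity>" unfolding T
    using bnd emeasure_bounded_finite bounded_interior by blast
qed

lemma triangle_integral_const:
  assumes "inj v" "\<not> affine_dependent (range v)"
    and f: "\<And>p. p \<in> rel_interior (convex hull (range v)) \<Longrightarrow> f p = a"
  shows "triangle_integral v f = a * norm (normal3 v) / fact (CARD(3) - 1)"
proof -
  let ?T = "{(s, t). 0 < s \<and> 0 < t \<and> s + t < (1::real)}"
  have "f (v 1 + fst p *\<^sub>R (v 2 - v 1) + snd p *\<^sub>R (v 3 - v 1)) = a" if "p \<in> ?T" for p
  proof -
    let ?u = "\<lambda>k::3. if k = 1 then 1 - fst p - snd p else if k = 2 then fst p else snd p"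
    have "v 1 + fst p *\<^sub>R (v 2 - v 1) + snd p *\<^sub>R (v 3 - v 1) = (\<Sum>k\<in>UNIV. ?u k *\<^sub>R v k)"
      by (simp add: sum_3 algebra_simps)
    also have "\<dots> \<in> rel_interior (convex hull (range v))"
      by (rule rel_interior_simplex_point[OF assms(1,2)]) (use that in \<open>auto simp: sum_3\<close>)
    finally show ?thesis by (rule f)
  qed
  then have "triangle_integral v f = (LINT p:?T|lborel. a * norm (normal3 v))"
    unfolding triangle_integral_def normal3_def
    by (intro set_lebesgue_integral_cong) (use reference_triangle in auto)
  also have "\<dots> = a * norm (normal3 v) / 2"
    using reference_triangle by (subst set_integral_const) auto
  finally show ?thesis by (simp add: fact_numeral)
qed

interpretation exact_d3: exact_surface_scheme normal3 mean_normal3 triangle_integral flux3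
proof
  show "2 \<le> CARD(3)" by simp
  show "v k \<bullet> normal3 v = v l \<bullet> normal3 v" for v k l
    by (metis normal3_orthogonal)
  show "flux3 v w k = flux3 v' w' k"
    if "\<And>r. r \<noteq> k \<Longrightarrow> v r = v' r \<and> w r = w' r" for v w v' w' k
    using that[of 1] that[of 2] that[of 3] exhaust_3[of k] by (auto simp: flux3_def)
  show "normal3 v \<noteq> 0" if "inj v" "\<not> affine_dependent (range v)" for v :: "3 \<Rightarrow> real^3"
    using that by (rule normal3_nonzero)
  show "triangle_integral v f = a * norm (normal3 v) / fact (CARD(3) - 1)"
    if "inj v" "\<not> affine_dependent (range v)"
      "\<And>p. p \<in> rel_interior (convex hull (range v)) \<Longrightarrow> f p = a" for v f a
    using that by (rule triangle_integral_const)
  show "(\<Sum>k\<in>UNIV. (w k - v k) \<bullet> mean_normal3 v w)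
      = w r \<bullet> normal3 w - v r \<bullet> normal3 v + (\<Sum>k\<in>UNIV. flux3 v w k)" for v w r
    by (rule mean_normal3_identity)
  show "flux3 (v \<circ> \<pi>) (w \<circ> \<pi>) k = - flux3 v w (\<pi> k)"
    if "\<pi> permutes UNIV" "\<not> evenperm \<pi>" for \<pi> v w k
    using that by (rule flux3_odd)
qed

section \<open>Conservation of volume and area\<close>

theorem theorem3p6:
  fixes \<Delta>t c\<^sub>0 :: real
  assumes "\<Delta>t > 0"
  shows
    "(\<forall>(\<Gamma> :: nat \<Rightarrow> 2 mesh) V c l \<mu> X \<kappa> \<alpha>.
        d2.two_stage_evolution \<Delta>t c\<^sub>0 \<Gamma> V c l \<mu> X \<kappa> \<alpha> \<longrightarrow>
        (\<forall>m. d2.vol (\<Gamma> (Suc m)) = d2.vol (\<Gamma> m) \<and> d2.area (\<Gamma> (Suc m)) = d2.area (\<Gamma> m))) \<and>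
     (\<forall>(\<Gamma> :: nat \<Rightarrow> 3 mesh) V c l \<mu> X \<kappa> \<alpha>.
        d3.two_stage_evolution \<Delta>t c\<^sub>0 \<Gamma> V c l \<mu> X \<kappa> \<alpha> \<longrightarrow>
        (\<forall>m. d3.vol (\<Gamma> (Suc m)) = d3.vol (\<Gamma> m) \<and> d3.area (\<Gamma> (Suc m)) = d3.area (\<Gamma> m)))"
  by (intro conjI allI impI; rule exact_d2.two_stage_conservation[OF assms]
      exact_d3.two_stage_conservation[OF assms]; assumption)

end
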